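(* Let $\mathcal{S}=\{(1,b_1),\dots,(1,b_m)\}$ be a set of steps with distinct $b_\ell\in\mathbb{Z}$, with positive real weights $w_1,\dots,w_m$, characteristic polynomial $P(X)=\sum_{\ell=1}^m w_\ell X^{b_\ell}$, and $c=-\min_\ell b_\ell\ge1$. For $j\ge0$, the generating function $T_j(z)$ of weighted meanders with these steps and weights starting at level $j$ is given by $$T_j(z)=T(z)\left(1-\sum_{\ell=1}^{c}\frac{\Big(\prod_{1\le i<k\le c}(X_i-X_k)\Big)\Big|_{X_\ell=1}}{\prod_{1\le i<k\le c}(X_i-X_k)}\,X_\ell^{c+j}\right)=\frac{1}{1-zP(1)}\Big(\sum_{f=0}^{j}h_f(X_1,\dots,X_c)\Big)\prod_{\ell=1}^{c}(1-X_\ell),$$ where $T(z)=\frac1{1-zP(1)}$, $X_1,\dots,X_c$ are the small solutions of the characteristic equation $1-zP(X)=0$, $h_f(X_1,\dots,X_c)=\sum_{1\le i_1\le\dots\le i_f\le c}\prod_{\ell=1}^f X_{i_\ell}$ is the complete homogeneous symmetric polynomial of degree $f$, and $(\cdot)|_{X_\ell=1}$ means that $X_\ell$ is replaced by $1$ in the product.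
   Context: A meander of length $n$ starting at level $j\ge0$ is a lattice path $(0,j)=p_0,p_1,\dots,p_n$ with $p_i-p_{i-1}\in\mathcal{S}$ for all $i$ whose points all have nonnegative second coordinate (the end level is arbitrary). The weight of a path is the product of the weights of its steps (step $(1,b_\ell)$ has weight $w_\ell$). $T_j(z)=\sum_{n\ge0}t_{n,j}z^n$, where $t_{n,j}$ is the total weight of meanders of length $n$ starting at level $j$. The small solutions $X_1,\dots,X_c$ are the $c$ Puiseux series solutions $X\in\bigcup_{m\ge1}\mathbb{C}((z^{1/m}))$ of $1-zP(X)=0$ with positive order in $z$ (i.e. tending to $0$ as $z\to 0$); they are pairwise distinct. *)

theory Defs
  imports
    "HOL-Computational_Algebra.Computational_Algebra"
    "HOL-Library.Product_Plus"
    Complex_Main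
begin

unbundle fps_syntax

section \<open>Puiseux series\<close>

lemma fls_compose_power_compose_power:
  assumes "m > 0" "n > 0"
  shows "fls_compose_power (fls_compose_power f m) n = fls_compose_power f (m * n)"
proof (rule fls_eqI)
  fix k :: int
  have "k div int n div int m = k div (int m * int n)"
    by (metis mult.commute of_nat_0_le_iff zdiv_zmult2_eq)
  moreover have "int m * int n dvd k \<longleftrightarrow> int n dvd k \<and> int m dvd k div int n"
    using assms by (metis dvd_div_iff_mult dvd_mult_right of_nat_0_less_iff order_less_irrefl)
  ultimately show "fls_compose_power (fls_compose_power f m) n $$ k =
      fls_compose_power f (m * n) $$ k"
    using assms by (simp add: fls_nth_compose_power)
qed

lemma fls_compose_power_cong_mult:
  assumes "fls_compose_power f m = fls_compose_power g n" "m > 0" "n > 0" "k > 0"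
  shows "fls_compose_power f (m * k) = fls_compose_power g (n * k)"
  using assms by (simp flip: fls_compose_power_compose_power)

lemma fls_compose_power_eq_iff [simp]:
  assumes "d > 0"
  shows "fls_compose_power f d = fls_compose_power g d \<longleftrightarrow> f = g"
proof
  assume *: "fls_compose_power f d = fls_compose_power g d"
  show "f = g"
  proof (rule fls_eqI)
    fix k :: int
    have "fls_compose_power f d $$ (int d * k) = fls_compose_power g d $$ (int d * k)"
      by (simp add: *)
    then show "f $$ k = g $$ k" using assms by (simp add: fls_nth_compose_power)
  qed
qed auto

lemma fls_compose_power_inverse:
  fixes f :: "'a :: field fls"
  assumes "d > 0"
  shows "fls_compose_power (inverse f) d = inverse (fls_compose_power f d)"
proof (cases "f = 0")
  case False
  then have "fls_compose_power f d * fls_compose_power (inverse f) d = 1"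
    using assms by (simp flip: fls_compose_power_mult)
  then show ?thesis by (metis inverse_unique)
qed auto

lemma fls_subdegree_compose_power:
  assumes "d > 0"
  shows "fls_subdegree (fls_compose_power f d) = int d * fls_subdegree f"
proof (cases "f = 0")
  case False
  show ?thesis
  proof (rule fls_subdegree_eqI)
    show "fls_compose_power f d $$ (int d * fls_subdegree f) \<noteq> 0"
      using assms False by (simp add: fls_nth_compose_power)
  next
    fix k assume k: "k < int d * fls_subdegree f"
    have "k div int d < fls_subdegree f" if "int d dvd k"
      using that k assms by auto
    then show "fls_compose_power f d $$ k = 0"
      using assms by (simp add: fls_nth_compose_power)
  qed
qed auto

text \<open>
  The pair \<open>(m, f)\<close> with \<open>m > 0\<close> stands for the series \<open>f(z\<^sup>1\<^sup>/\<^sup>m)\<close>, so that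
  \<open>(m, f)\<close> and \<open>(n, g)\<close> denote the same series iff \<open>f(t\<^sup>n) = g(t\<^sup>m)\<close>. The type below is
  therefore the union of the fields of Laurent series in \<open>z\<^sup>1\<^sup>/\<^sup>m\<close> over all \<open>m \<ge> 1\<close>.
\<close>

fun puiseux_rel :: "nat \<times> 'a :: field fls \<Rightarrow> nat \<times> 'a fls \<Rightarrow> bool" where
  "puiseux_rel (m, f) (n, g) \<longleftrightarrow>
     m > 0 \<and> n > 0 \<and> fls_compose_power f n = fls_compose_power g m"

lemma part_equivp_puiseux_rel: "part_equivp (puiseux_rel :: nat \<times> 'a :: field fls \<Rightarrow> _)"
proof (rule part_equivpI)
  show "\<exists>x :: nat \<times> 'a fls. puiseux_rel x x" by (rule exI[of _ "(1, 0)"]) auto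
  show "symp (puiseux_rel :: nat \<times> 'a :: field fls \<Rightarrow> _)" by (rule sympI) auto
  show "transp (puiseux_rel :: nat \<times> 'a :: field fls \<Rightarrow> _)"
  proof (rule transpI; clarify)
    fix l m n :: nat and f g h :: "'a fls"
    assume 1: "puiseux_rel (l, f) (m, g)" and 2: "puiseux_rel (m, g) (n, h)"
    have "fls_compose_power (fls_compose_power f n) m = fls_compose_power f (m * n)"
      using 1 2 by (simp add: fls_compose_power_compose_power mult.commute)
    also have "\<dots> = fls_compose_power g (l * n)"
      using 1 2 by (intro fls_compose_power_cong_mult) auto
    also have "\<dots> = fls_compose_power g (n * l)"
      by (simp add: mult.commute)
    also have "\<dots> = fls_compose_power h (m * l)"
      using 1 2 by (intro fls_compose_power_cong_mult) auto
    also have "\<dots> = fls_compose_power (fls_compose_power h l) m"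
      using 1 2 by (simp add: fls_compose_power_compose_power mult.commute)
    finally show "puiseux_rel (l, f) (n, h)" using 1 2 by simp
  qed
qed

quotient_type (overloaded) 'a puiseux = "nat \<times> 'a :: field fls" / partial: puiseux_rel
  by (rule part_equivp_puiseux_rel)

text \<open>\<open>puiseux_root m f\<close> is the series \<open>f(z\<^sup>1\<^sup>/\<^sup>m)\<close> (for \<open>m > 0\<close>).\<close>

definition puiseux_root :: "nat \<Rightarrow> 'a :: field fls \<Rightarrow> 'a puiseux" where
  "puiseux_root m f = abs_puiseux (m, f)"

lemma puiseux_root_eq_iff:
  assumes "m > 0" "n > 0"
  shows "puiseux_root m f = puiseux_root n g \<longleftrightarrow> fls_compose_power f n = fls_compose_power g m"
  using Quotient3_rel[OF Quotient3_puiseux, of "(m, f)" "(n, g)"] assms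
  by (simp add: puiseux_root_def)

lemma puiseux_root_compose_power:
  "m > 0 \<Longrightarrow> d > 0 \<Longrightarrow> puiseux_root (m * d) (fls_compose_power f d) = puiseux_root m f"
  by (simp add: puiseux_root_eq_iff fls_compose_power_compose_power mult.commute)

lemma puiseux_cases:
  obtains m f where "m > 0" "X = puiseux_root m f"
proof -
  obtain m f where mf: "rep_puiseux X = (m, f)" by (cases "rep_puiseux X")
  have "puiseux_rel (m, f) (m, f)"
    using Quotient3_rep_reflp[OF Quotient3_puiseux, of X] by (simp add: mf)
  moreover have "X = puiseux_root m f"
    using Quotient3_abs_rep[OF Quotient3_puiseux, of X] by (simp add: mf puiseux_root_def)
  ultimately show ?thesis using that by simp
qed

lemma puiseux_cases2:
  obtains m f g where "m > 0" "X = puiseux_root m f" "Y = puiseux_root m g"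
proof -
  obtain m f where X: "m > 0" "X = puiseux_root m f" by (rule puiseux_cases)
  obtain n g where Y: "n > 0" "Y = puiseux_root n g" by (rule puiseux_cases)
  have "X = puiseux_root (m * n) (fls_compose_power f n)"
    using X Y by (simp add: puiseux_root_compose_power)
  moreover have "Y = puiseux_root (m * n) (fls_compose_power g m)"
    using X Y by (simp add: puiseux_root_compose_power mult.commute[of m n])
  ultimately show ?thesis using that[of "m * n"] X Y by simp
qed

lemma puiseux_cases3:
  obtains m f g h where "m > 0" "X = puiseux_root m f" "Y = puiseux_root m g" "Z = puiseux_root m h"
proof -
  obtain m f g where XY: "m > 0" "X = puiseux_root m f" "Y = puiseux_root m g"
    by (rule puiseux_cases2)
  obtain n h where Z: "n > 0" "Z = puiseux_root n h" by (rule puiseux_cases)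
  have "X = puiseux_root (m * n) (fls_compose_power f n)"
       "Y = puiseux_root (m * n) (fls_compose_power g n)"
    using XY Z by (simp_all add: puiseux_root_compose_power)
  moreover have "Z = puiseux_root (m * n) (fls_compose_power h m)"
    using XY Z by (simp add: puiseux_root_compose_power mult.commute[of m n])
  ultimately show ?thesis using that[of "m * n"] XY Z by simp
qed

lift_definition puiseux_plus :: "'a :: field puiseux \<Rightarrow> 'a puiseux \<Rightarrow> 'a puiseux" is
  "\<lambda>(m, f) (n, g). (m * n, fls_compose_power f n + fls_compose_power g m)"
proof (clarify, goal_cases)
  case (1 m f m' f' n g n' g')
  have "fls_compose_power f (m' * (n * n')) = fls_compose_power f' (m * (n * n'))"
    using 1 by (intro fls_compose_power_cong_mult) auto
  moreover have "fls_compose_power g (n' * (m * m')) = fls_compose_power g' (n * (m * m'))"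
    using 1 by (intro fls_compose_power_cong_mult) auto
  ultimately show ?case using 1 by (simp add: fls_compose_power_compose_power ac_simps)
qed

lift_definition puiseux_times :: "'a :: field puiseux \<Rightarrow> 'a puiseux \<Rightarrow> 'a puiseux" is
  "\<lambda>(m, f) (n, g). (m * n, fls_compose_power f n * fls_compose_power g m)"
proof (clarify, goal_cases)
  case (1 m f m' f' n g n' g')
  have "fls_compose_power f (m' * (n * n')) = fls_compose_power f' (m * (n * n'))"
    using 1 by (intro fls_compose_power_cong_mult) auto
  moreover have "fls_compose_power g (n' * (m * m')) = fls_compose_power g' (n * (m * m'))"
    using 1 by (intro fls_compose_power_cong_mult) auto
  ultimately show ?case using 1 by (simp add: fls_compose_power_compose_power ac_simps)
qed

lift_definition puiseux_uminus :: "'a :: field puiseux \<Rightarrow> 'a puiseux" is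
  "\<lambda>(m, f). (m, - f)"
  by auto

lift_definition puiseux_inverse :: "'a :: field puiseux \<Rightarrow> 'a puiseux" is
  "\<lambda>(m, f). (m, inverse f)"
  by (auto simp: fls_compose_power_inverse)

lemma puiseux_plus_root:
  assumes "m > 0"
  shows "puiseux_plus (puiseux_root m f) (puiseux_root m g) = puiseux_root m (f + g)"
proof -
  have "puiseux_plus (puiseux_root m f) (puiseux_root m g) =
      puiseux_root (m * m) (fls_compose_power (f + g) m)"
    using assms by (simp add: puiseux_root_def puiseux_plus.abs_eq)
  then show ?thesis using assms by (simp only: puiseux_root_compose_power)
qed

lemma puiseux_times_root:
  assumes "m > 0"
  shows "puiseux_times (puiseux_root m f) (puiseux_root m g) = puiseux_root m (f * g)"
proof -
  have "puiseux_times (puiseux_root m f) (puiseux_root m g) =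
      puiseux_root (m * m) (fls_compose_power (f * g) m)"
    using assms by (simp add: puiseux_root_def puiseux_times.abs_eq)
  then show ?thesis using assms by (simp only: puiseux_root_compose_power)
qed

lemma puiseux_uminus_root:
  assumes "m > 0"
  shows "puiseux_uminus (puiseux_root m f) = puiseux_root m (- f)"
  using assms by (simp add: puiseux_root_def puiseux_uminus.abs_eq)

lemma puiseux_inverse_root:
  assumes "m > 0"
  shows "puiseux_inverse (puiseux_root m f) = puiseux_root m (inverse f)"
  using assms by (simp add: puiseux_root_def puiseux_inverse.abs_eq)

lemma puiseux_root_const:
  assumes "m > 0"
  shows "puiseux_root 1 (fls_const a) = puiseux_root m (fls_const a)"
  using assms by (simp add: puiseux_root_eq_iff)

instantiation puiseux :: (field) field
begin

definition "0 = (puiseux_root 1 0 :: 'a puiseux)"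
definition "1 = (puiseux_root 1 1 :: 'a puiseux)"
definition "X + Y = puiseux_plus X (Y :: 'a puiseux)"
definition "X * Y = puiseux_times X (Y :: 'a puiseux)"
definition "- X = puiseux_uminus (X :: 'a puiseux)"
definition "X - Y = X + - (Y :: 'a puiseux)"
definition "inverse X = puiseux_inverse (X :: 'a puiseux)"
definition "X div Y = X * inverse (Y :: 'a puiseux)"

lemma puiseux_zero_root: "m > 0 \<Longrightarrow> (0 :: 'a puiseux) = puiseux_root m 0"
  using puiseux_root_const[of m "0 :: 'a"] by (simp add: zero_puiseux_def)

lemma puiseux_one_root: "m > 0 \<Longrightarrow> (1 :: 'a puiseux) = puiseux_root m 1"
  using puiseux_root_const[of m "1 :: 'a"] by (simp add: one_puiseux_def)

lemma puiseux_arith_root: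
  assumes "m > 0"
  shows "puiseux_root m f + puiseux_root m g = puiseux_root m (f + g :: 'a fls)"
    and "puiseux_root m f * puiseux_root m g = puiseux_root m (f * g :: 'a fls)"
    and "- puiseux_root m f = puiseux_root m (- f :: 'a fls)"
    and "inverse (puiseux_root m f) = puiseux_root m (inverse f :: 'a fls)"
  by (simp_all only: assms plus_puiseux_def times_puiseux_def uminus_puiseux_def inverse_puiseux_def
      puiseux_plus_root puiseux_times_root puiseux_uminus_root puiseux_inverse_root)

instance
proof
  fix X Y Z :: "'a puiseux"
  obtain m f g h where m: "m > 0" and
    XYZ: "X = puiseux_root m f" "Y = puiseux_root m g" "Z = puiseux_root m h"
    by (rule puiseux_cases3)
  note simps = XYZ puiseux_arith_root[OF m] puiseux_zero_root[OF m] puiseux_one_root[OF m]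
  show "X * Y * Z = X * (Y * Z)" "X * Y = Y * X" "1 * X = X" "(X + Y) * Z = X * Z + Y * Z"
    "X + Y + Z = X + (Y + Z)" "X + Y = Y + X" "0 + X = X" "- X + X = 0"
    by (simp_all add: simps algebra_simps)
  show "inverse X * X = 1" if "X \<noteq> 0"
    using that by (cases "f = 0") (auto simp: simps)
  show "(0 :: 'a puiseux) \<noteq> 1"
    by (simp add: zero_puiseux_def one_puiseux_def puiseux_root_eq_iff)
  show "inverse (0 :: 'a puiseux) = 0"
    by (simp add: puiseux_zero_root[OF m] puiseux_arith_root[OF m])
  show "X - Y = X + - Y" by (simp add: minus_puiseux_def)
  show "X div Y = X * inverse Y" by (simp add: divide_puiseux_def)
qed

end

text \<open>The order in \<open>z\<close> (which is \<open>0\<close> for the zero series by convention).\<close>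

lift_definition puiseux_order :: "'a :: field puiseux \<Rightarrow> rat" is
  "\<lambda>(m, f). of_int (fls_subdegree f) / of_nat m"
proof (clarify, goal_cases)
  case (1 m f n g)
  then have "int n * fls_subdegree f = int m * fls_subdegree g"
    by (metis fls_subdegree_compose_power puiseux_rel.simps)
  then have "of_nat n * of_int (fls_subdegree f) = (of_nat m * of_int (fls_subdegree g) :: rat)"
    by (metis of_int_mult of_int_of_nat_eq)
  then show ?case using 1 by (simp add: field_simps)
qed

definition puiseux_of_fps :: "'a :: field fps \<Rightarrow> 'a puiseux" where
  "puiseux_of_fps f = puiseux_root 1 (fps_to_fls f)"

abbreviation puiseux_const :: "'a :: field \<Rightarrow> 'a puiseux" where
  "puiseux_const a \<equiv> puiseux_of_fps (fps_const a)"

abbreviation puiseux_z :: "'a :: field puiseux" where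
  "puiseux_z \<equiv> puiseux_of_fps fps_X"


section \<open>Meanders\<close>

definition step_set :: "nat \<Rightarrow> (nat \<Rightarrow> int) \<Rightarrow> (int \<times> int) set" where
  "step_set m b = (\<lambda>l. (1, b l)) ` {1..m}"

text \<open>Well defined on \<^term>\<open>step_set m b\<close> because the \<open>b\<^sub>l\<close> are distinct.\<close>

definition step_weight :: "nat \<Rightarrow> (nat \<Rightarrow> int) \<Rightarrow> (nat \<Rightarrow> real) \<Rightarrow> int \<times> int \<Rightarrow> real" where
  "step_weight m b w s = w (the_inv_into {1..m} (\<lambda>l. (1, b l)) s)"

definition meanders :: "nat \<Rightarrow> (nat \<Rightarrow> int) \<Rightarrow> nat \<Rightarrow> nat \<Rightarrow> (int \<times> int) list set" where
  "meanders m b n j = {p. length p = n + 1 \<and> p ! 0 = (0, int j) \<and>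
     (\<forall>i\<in>{1..n}. p ! i - p ! (i - 1) \<in> step_set m b) \<and> (\<forall>i\<in>{0..n}. snd (p ! i) \<ge> 0)}"

definition path_weight :: "nat \<Rightarrow> (nat \<Rightarrow> int) \<Rightarrow> (nat \<Rightarrow> real) \<Rightarrow> (int \<times> int) list \<Rightarrow> real" where
  "path_weight m b w p = (\<Prod>i = 1..<length p. step_weight m b w (p ! i - p ! (i - 1)))"

lemma finite_meanders: "finite (meanders m b n j)"
proof (induction n)
  case 0
  have "meanders m b 0 j \<subseteq> {[(0, int j)]}"
    by (auto simp: meanders_def length_Suc_conv)
  then show ?case by (rule finite_subset) simp
next
  case (Suc n)
  have "meanders m b (Suc n) j \<subseteq>
      (\<lambda>(p, s). p @ [last p + s]) ` (meanders m b n j \<times> step_set m b)"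
  proof
    fix p assume p: "p \<in> meanders m b (Suc n) j"
    define q where "q = butlast p"
    have len: "length p = n + 2" "length q = n + 1" using p by (auto simp: meanders_def q_def)
    have nth: "q ! i = p ! i" if "i \<le> n" for i
      using that len by (simp add: q_def nth_butlast)
    have "q ! (i - 1) = p ! (i - 1)" if "i \<in> {1..n}" for i
      using that by (intro nth) auto
    then have "q \<in> meanders m b n j"
      using p len nth by (auto simp: meanders_def)
    moreover have "last q = p ! n" using len nth by (simp add: last_conv_nth flip: length_0_conv)
    moreover have "p = q @ [p ! Suc n]"
      using len by (intro nth_equalityI) (auto simp: nth nth_append less_Suc_eq)
    moreover have "p ! Suc n - p ! n \<in> step_set m b"
      using p by (force simp: meanders_def dest: bspec[of _ _ "Suc n"])
    ultimately show "p \<in> (\<lambda>(p, s). p @ [last p + s]) ` (meanders m b n j \<times> step_set m b)"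
      by (intro image_eqI[of _ _ "(q, p ! Suc n - p ! n)"]) auto
  qed
  then show ?case
    by (rule finite_subset) (intro finite_imageI finite_cartesian_product Suc.IH, simp add: step_set_def)
qed

definition meander_total :: "nat \<Rightarrow> (nat \<Rightarrow> int) \<Rightarrow> (nat \<Rightarrow> real) \<Rightarrow> nat \<Rightarrow> nat \<Rightarrow> real" where
  "meander_total m b w n j = (\<Sum>p\<in>meanders m b n j. path_weight m b w p)"

definition meander_gf :: "nat \<Rightarrow> (nat \<Rightarrow> int) \<Rightarrow> (nat \<Rightarrow> real) \<Rightarrow> nat \<Rightarrow> complex fps" where
  "meander_gf m b w j = Abs_fps (\<lambda>n. complex_of_real (meander_total m b w n j))"


section \<open>Characteristic equation and small solutions\<close>

definition char_poly ::
    "nat \<Rightarrow> (nat \<Rightarrow> int) \<Rightarrow> (nat \<Rightarrow> real) \<Rightarrow> complex puiseux \<Rightarrow> complex puiseux" where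
  "char_poly m b w X = (\<Sum>l = 1..m. puiseux_const (complex_of_real (w l)) * X powi b l)"

text \<open>A series of positive \<^const>\<open>puiseux_order\<close> is nonzero, so negative powers are genuine.\<close>

definition small_solutions ::
    "nat \<Rightarrow> (nat \<Rightarrow> int) \<Rightarrow> (nat \<Rightarrow> real) \<Rightarrow> complex puiseux set" where
  "small_solutions m b w = {X. puiseux_order X > 0 \<and> 1 - puiseux_z * char_poly m b w X = 0}"

lemma puiseux_root_power:
  "n > 0 \<Longrightarrow> puiseux_root n f ^ k = puiseux_root n (f ^ k)"
  by (induction k) (simp_all add: puiseux_arith_root puiseux_one_root[of n])

lemma puiseux_root_sum:
  "n > 0 \<Longrightarrow> (\<Sum>x\<in>A. puiseux_root n (f x)) = puiseux_root n (\<Sum>x\<in>A. f x)"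
  by (induction A rule: infinite_finite_induct)
    (simp_all add: puiseux_arith_root puiseux_zero_root[of n])

lemma puiseux_order_root:
  "n > 0 \<Longrightarrow> puiseux_order (puiseux_root n f) = of_int (fls_subdegree f) / of_nat n"
  by (simp add: puiseux_root_def puiseux_order.abs_eq)

lemma puiseux_root_inject:
  "n > 0 \<Longrightarrow> puiseux_root n f = puiseux_root n g \<longleftrightarrow> f = g"
  by (simp add: puiseux_root_eq_iff)

lemma puiseux_const_root: "n > 0 \<Longrightarrow> puiseux_const a = puiseux_root n (fls_const a)"
  using puiseux_root_const[of n a] by (simp add: puiseux_of_fps_def)

lemma puiseux_z_root: "n > 0 \<Longrightarrow> puiseux_z = puiseux_root n (fps_to_fls (fps_X ^ n))"
  using puiseux_root_compose_power[of 1 n "fps_to_fls fps_X", symmetric]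
  by (simp add: puiseux_of_fps_def fls_compose_power_fps_to_fls del: fps_X_to_fls)

lemma fps_power_eq_1_imp_const:
  fixes U :: "complex fps"
  assumes "U ^ c = 1" "c > 0"
  shows "U = fps_const (U $ 0)" "(U $ 0) ^ c = 1"
proof -
  have "U \<noteq> 0" using assms by (auto simp: power_0_left)
  moreover have "of_nat c * fps_deriv U * U ^ (c - 1) = 0"
    using arg_cong[OF assms(1), of fps_deriv] by (simp add: fps_deriv_power')
  ultimately show "U = fps_const (U $ 0)"
    using assms(2) by simp
  show "(U $ 0) ^ c = 1"
    using arg_cong[OF assms(1), of "\<lambda>f. f $ 0"] by (simp add: fps_nth_power_0)
qed

text \<open>Clearing denominators turns \<open>1 - z P(X) = 0\<close> into \<open>X\<^sup>c = z Q(X)\<close> with \<open>Q(0) \<noteq> 0\<close>.\<close>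

lemma small_solutions_root_iff:
  assumes inj: "inj_on b {1..m}" and w: "\<And>l. l \<in> {1..m} \<Longrightarrow> w l > 0" and m: "m \<ge> 1"
    and c: "int c = - Min (b ` {1..m})" and n: "n > 0"
  defines "Q \<equiv> \<Sum>l = 1..m. fps_const (complex_of_real (w l)) * fps_X ^ nat (b l + int c)"
  shows "puiseux_root n f \<in> small_solutions m b w \<longleftrightarrow>
    (\<exists>F. f = fps_to_fls F \<and> F \<noteq> 0 \<and> F $ 0 = 0 \<and> F ^ c = fps_X ^ n * (Q oo F))"
proof -
  have bc: "b l + int c \<ge> 0" if "l \<in> {1..m}" for l
  proof -
    have "Min (b ` {1..m}) \<le> b l" using that by (intro Min_le) auto
    then show ?thesis using c by linarith
  qed
  have eq: "1 - puiseux_z * char_poly m b w (puiseux_root n (fps_to_fls F)) = 0 \<longleftrightarrow>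
      F ^ c = fps_X ^ n * (Q oo F)" if F: "F \<noteq> 0" "F $ 0 = 0" for F
  proof -
    let ?X = "puiseux_root n (fps_to_fls F)"
    have X0: "?X \<noteq> 0"
      using n F by (simp add: puiseux_zero_root[of n] puiseux_root_inject)
    have "?X ^ c * char_poly m b w ?X =
        (\<Sum>l = 1..m. puiseux_const (complex_of_real (w l)) * ?X ^ nat (b l + int c))"
      unfolding char_poly_def sum_distrib_left
    proof (intro sum.cong refl)
      fix l assume l: "l \<in> {1..m}"
      have "?X powi b l * ?X ^ c = ?X powi (b l + int c)"
        using X0 by (simp add: power_int_add)
      also have "\<dots> = ?X ^ nat (b l + int c)"
        using bc[OF l] by (simp add: power_int_def)
      finally show "?X ^ c * (puiseux_const (complex_of_real (w l)) * ?X powi b l) =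
          puiseux_const (complex_of_real (w l)) * ?X ^ nat (b l + int c)"
        by (simp add: algebra_simps)
    qed
    also have "\<dots> = puiseux_root n (\<Sum>l = 1..m. fls_const (complex_of_real (w l)) *
        fps_to_fls (F ^ nat (b l + int c)))"
      using n by (simp add: puiseux_const_root[OF n] puiseux_root_power puiseux_arith_root
          puiseux_root_sum fps_to_fls_power)
    also have "(\<Sum>l = 1..m. fls_const (complex_of_real (w l)) * fps_to_fls (F ^ nat (b l + int c)))
        = fps_to_fls (\<Sum>l = 1..m. fps_const (complex_of_real (w l)) * F ^ nat (b l + int c))"
      by (induction m) (simp_all add: fls_times_fps_to_fls)
    also have "(\<Sum>l = 1..m. fps_const (complex_of_real (w l)) * F ^ nat (b l + int c)) = Q oo F"
      unfolding Q_def using F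
      by (simp add: fps_compose_sum_distrib fps_compose_mult_distrib fps_X_power_compose)
    finally have *: "?X ^ c * char_poly m b w ?X = puiseux_root n (fps_to_fls (Q oo F))" .
    have "1 - puiseux_z * char_poly m b w ?X = 0 \<longleftrightarrow>
        ?X ^ c * (1 - puiseux_z * char_poly m b w ?X) = 0"
      using X0 by simp
    also have "\<dots> \<longleftrightarrow> ?X ^ c = puiseux_z * (?X ^ c * char_poly m b w ?X)"
      by (simp add: algebra_simps)
    also have "\<dots> \<longleftrightarrow> F ^ c = fps_X ^ n * (Q oo F)"
      unfolding * puiseux_z_root[OF n]
      using n by (simp add: puiseux_root_power puiseux_arith_root puiseux_root_inject
          flip: fps_to_fls_power fls_times_fps_to_fls del: fps_X_to_fls)
    finally show ?thesis .
  qed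
  have ord: "0 < fls_subdegree f \<longleftrightarrow> (\<exists>F. f = fps_to_fls F \<and> F \<noteq> 0 \<and> F $ 0 = 0)"
  proof
    assume f: "0 < fls_subdegree f"
    then have "f = fps_to_fls (fls_regpart f)" "f \<noteq> 0" "fls_regpart f $ 0 = 0" by auto
    then show "\<exists>F. f = fps_to_fls F \<and> F \<noteq> 0 \<and> F $ 0 = 0" by (metis fps_zero_to_fls)
  next
    assume "\<exists>F. f = fps_to_fls F \<and> F \<noteq> 0 \<and> F $ 0 = 0"
    then show "0 < fls_subdegree f"
      by (auto simp: fls_subdegree_fls_to_fps subdegree_eq_0_iff intro!: gr0I)
  qed
  show ?thesis
  proof -
    have "0 < (of_int (fls_subdegree f) / of_nat n :: rat) \<longleftrightarrow> 0 < fls_subdegree f"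
      using n by (simp add: zero_less_divide_iff)
    then show ?thesis
      using ord eq unfolding small_solutions_def mem_Collect_eq puiseux_order_root[OF n] by blast
  qed
qed

lemma card_small_solutions:
  assumes inj: "inj_on b {1..m}" and w: "\<And>l. l \<in> {1..m} \<Longrightarrow> w l > 0" and m: "m \<ge> 1"
    and c: "int c = - Min (b ` {1..m})" and c1: "c \<ge> 1"
  shows "finite (small_solutions m b w)" "card (small_solutions m b w) = c"
proof -
  define Q where "Q = (\<Sum>l = 1..m. fps_const (complex_of_real (w l)) * fps_X ^ nat (b l + int c))"
  have iff: "puiseux_root n f \<in> small_solutions m b w \<longleftrightarrow>
      (\<exists>F. f = fps_to_fls F \<and> F \<noteq> 0 \<and> F $ 0 = 0 \<and> F ^ c = fps_X ^ n * (Q oo F))"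
    if "n > 0" for n f
    using small_solutions_root_iff[where w = w, OF inj w m c that] by (simp add: Q_def)
  have "Min (b ` {1..m}) \<in> b ` {1..m}" using m by (intro Min_in) auto
  then obtain l0 where "l0 \<in> {1..m}" "Min (b ` {1..m}) = b l0" by blast
  then have l0: "l0 \<in> {1..m}" "b l0 = - int c" using c by linarith+
  have "Q $ 0 = (\<Sum>l = 1..m. if l = l0 then complex_of_real (w l) else 0)"
    unfolding Q_def fps_sum_nth
  proof (intro sum.cong refl)
    fix l assume l: "l \<in> {1..m}"
    have "Min (b ` {1..m}) \<le> b l" using l by (intro Min_le) auto
    then have "b l \<ge> - int c" using c by linarith
    moreover have "b l \<noteq> b l0" if "l \<noteq> l0" using that l l0 inj by (meson inj_onD)
    ultimately have "nat (b l + int c) = 0 \<longleftrightarrow> l = l0"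
      using l0 by (cases "l = l0") auto
    then show "(fps_const (complex_of_real (w l)) * fps_X ^ nat (b l + int c)) $ 0 =
        (if l = l0 then complex_of_real (w l) else 0)"
      by (auto simp: fps_X_power_nth)
  qed
  then have Q0: "Q $ 0 \<noteq> 0" using l0 w[of l0] by (simp add: sum.delta)

  obtain s where s: "s ^ c = Q $ 0"
    using card_nth_roots[OF Q0, of c] c1
    by (metis (mono_tags, lifting) Collect_empty_eq card.empty not_one_le_zero zero_less_one
        order_less_le_trans)
  define phi where "phi = fps_radical (\<lambda>_ _. s) c Q"
  have phi: "phi ^ c = Q"
    using power_radical[OF Q0, of "\<lambda>_ _. s" "c - 1"] s c1 by (simp add: phi_def)
  have phi0: "phi $ 0 \<noteq> 0" using phi Q0 c1 by (metis fps_nth_power_0 power_0_left not_one_le_zero)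
  define G where "G = fps_X * inverse phi"
  define Y where "Y = fps_inv G"
  have G: "G $ 0 = 0" "G $ 1 \<noteq> 0" using phi0 by (simp_all add: G_def)
  have Y0: "Y $ 0 = 0" by (simp add: Y_def fps_inv_def)
  have GY: "G oo Y = fps_X" and YG: "Y oo G = fps_X"
    using fps_inv_right[OF G] fps_inv[OF G] by (simp_all add: Y_def)

  have sol: "F ^ c = fps_X ^ n * (Q oo F) \<longleftrightarrow> (G oo F) ^ c = fps_X ^ n" if F: "F $ 0 = 0" for F n
  proof -
    have "(phi oo F) * (G oo F) = F"
      using F phi0 by (simp add: G_def fps_compose_mult_distrib fps_inverse_compose mult_ac
          inverse_mult_eq_1')
    then have "F ^ c = (Q oo F) * (G oo F) ^ c"
      using F phi by (metis power_mult_distrib fps_compose_power)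
    moreover have "Q oo F \<noteq> 0" using Q0 F by (auto simp: fps_compose_eq_0_iff)
    ultimately show ?thesis by (simp add: mult.commute)
  qed

  define S where "S = (\<lambda>\<zeta>. puiseux_root c (fps_to_fls (Y oo (fps_const \<zeta> * fps_X))))"
  have YS: "G oo (Y oo (fps_const \<zeta> * fps_X)) = fps_const \<zeta> * fps_X" for \<zeta>
    by (simp add: fps_compose_assoc Y0 GY)
  have inj_S: "inj_on S {\<zeta>. \<zeta> ^ c = 1}"
  proof
    fix \<zeta> \<xi> assume "S \<zeta> = S \<xi>"
    then have "Y oo (fps_const \<zeta> * fps_X) = Y oo (fps_const \<xi> * fps_X)"
      using c1 by (simp add: S_def puiseux_root_inject)
    then have "fps_const \<zeta> * fps_X = fps_const \<xi> * (fps_X :: complex fps)" using YS by metis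
    then have "(fps_const \<zeta> * fps_X) $ 1 = (fps_const \<xi> * (fps_X :: complex fps)) $ 1" by metis
    then show "\<zeta> = \<xi>" by simp
  qed
  have "small_solutions m b w = S ` {\<zeta>. \<zeta> ^ c = 1}"
  proof (intro equalityI subsetI)
    fix Z assume "Z \<in> S ` {\<zeta>. \<zeta> ^ c = 1}"
    then obtain \<zeta> where z: "\<zeta> ^ c = 1" "Z = S \<zeta>" by auto
    let ?F = "Y oo (fps_const \<zeta> * fps_X)"
    have F0: "?F $ 0 = 0" by (simp add: Y0)
    have "?F \<noteq> 0"
    proof
      assume "?F = 0"
      then have "fps_const \<zeta> * fps_X = (0 :: complex fps)" using YS[of \<zeta>] G(1) by simp
      then show False using z c1 by (auto simp: power_0_left)
    qed
    moreover have "?F ^ c = fps_X ^ c * (Q oo ?F)"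
      unfolding sol[OF F0] YS using z by (simp add: power_mult_distrib fps_const_power)
    ultimately show "Z \<in> small_solutions m b w"
      using F0 c1 iff[where n = c and f = "fps_to_fls ?F"] by (auto simp: z(2) S_def)
  next
    fix Z assume Z: "Z \<in> small_solutions m b w"
    obtain n f where n: "n > 0" "Z = puiseux_root n f" by (rule puiseux_cases)
    obtain F where F: "f = fps_to_fls F" "F $ 0 = 0" "F ^ c = fps_X ^ n * (Q oo F)"
      using iff[where n = n and f = f] n Z by auto
    define H where "H = G oo F"
    have Hc: "H ^ c = fps_X ^ n" using F sol by (simp add: H_def)
    define k where "k = subdegree H"
    define U where "U = fps_shift k H"
    have HU: "H = U * fps_X ^ k" unfolding U_def k_def by (rule subdegree_decompose)
    have nk: "n = c * k" using arg_cong[OF Hc, of subdegree] by (simp add: k_def)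
    have "U ^ c * fps_X ^ n = 1 * fps_X ^ n"
      using Hc by (simp add: HU power_mult_distrib nk power_mult mult.commute[of c k])
    then have "U ^ c = 1" by (simp only: mult_cancel_right) simp
    note U = fps_power_eq_1_imp_const[OF this]
    have "F = Y oo H"
      using F(2) G(1) YG by (simp add: H_def fps_compose_assoc)
    also have "H = (fps_const (U $ 0) * fps_X) oo (fps_X ^ k)"
    proof -
      have "(fps_const (U $ 0) * fps_X) oo (fps_X ^ k) = fps_const (U $ 0) * fps_X ^ k"
        using n nk by (simp add: fps_compose_mult_distrib)
      then show ?thesis using HU U(1) c1 by simp
    qed
    also have "Y oo \<dots> = (Y oo (fps_const (U $ 0) * fps_X)) oo (fps_X ^ k)"
      using n nk by (intro fps_compose_assoc) auto
    finally have "fps_to_fls F =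
        fls_compose_power (fps_to_fls (Y oo (fps_const (U $ 0) * fps_X))) k"
      using n nk by (simp add: fls_compose_power_fps_to_fls)
    then have "Z = S (U $ 0)"
      using n nk c1 by (simp add: F S_def puiseux_root_compose_power)
    then show "Z \<in> S ` {\<zeta>. \<zeta> ^ c = 1}" using U c1 by auto
  qed
  moreover have "card (S ` {\<zeta>. \<zeta> ^ c = 1}) = c"
    using card_image[OF inj_S] card_roots_unity_eq[of c] c1 by simp
  ultimately show card: "card (small_solutions m b w) = c" by simp
  show "finite (small_solutions m b w)"
    using card c1 by (intro card_ge_0_finite) simp
qed

definition diff_prod :: "nat \<Rightarrow> (nat \<Rightarrow> 'a) \<Rightarrow> 'a :: comm_ring_1" where
  "diff_prod c X = (\<Prod>(i, k)\<in>{(i, k). 1 \<le> i \<and> i < k \<and> k \<le> c}. X i - X k)"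

definition complete_homogeneous :: "nat \<Rightarrow> nat \<Rightarrow> (nat \<Rightarrow> 'a) \<Rightarrow> 'a :: comm_ring_1" where
  "complete_homogeneous c f X =
     (\<Sum>is\<in>{is. length is = f \<and> sorted is \<and> set is \<subseteq> {1..c}}. \<Prod>l<f. X (is ! l))"

unbundle no fps_syntax

end

theory Submission
  imports Defs
begin

text \<open>
  Conditioning on the first step gives \<open>T\<^sub>j = 1 + z \<Sum>\<^sub>s w\<^sub>s T\<^bsub>j + b\<^sub>s\<^esub>\<close>, where terms with \<open>j + b\<^sub>s < 0\<close> are
  omitted. Iterating the homogeneous version of this system gains a factor \<open>z\<close> each time, so it has
  at most one solution of uniformly bounded order. For arbitrary coefficients \<open>a\<^sub>l\<close> the expression
  \<open>T(z) (1 - \<Sum>\<^sub>l a\<^sub>l X\<^sub>l\<^bsup>c + j\<^esup>)\<close> satisfies the recurrence without boundary, because \<open>z P(X\<^sub>l) = 1\<close>;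
  the quotients of Vandermonde products are the values at \<open>1\<close> of the Lagrange basis polynomials of
  the nodes \<open>X\<^sub>1, \<dots>, X\<^sub>c\<close>, which makes it vanish for \<open>-c \<le> j < 0\<close>. The product form follows
  by telescoping from \<open>h\<^sub>f = \<Sum>\<^sub>l X\<^sub>l\<^bsup>c - 1 + f\<^esup> / \<Prod>\<^bsub>k \<noteq> l\<^esub> (X\<^sub>l - X\<^sub>k)\<close>.
\<close>

section \<open>Lagrange interpolation and complete homogeneous polynomials\<close>

lemma complete_homogeneous_0 [simp]: "complete_homogeneous c 0 X = 1"
proof -
  have "{is. length is = 0 \<and> sorted is \<and> set is \<subseteq> {1..c}} = {[]}" by auto
  then show ?thesis by (simp add: complete_homogeneous_def)
qed

lemma complete_homogeneous_no_variables [simp]: "complete_homogeneous 0 (Suc f) X = 0"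
proof -
  have "{is :: nat list. length is = Suc f \<and> sorted is \<and> set is \<subseteq> {1..0}} = {}"
    by (auto simp: length_Suc_conv)
  then show ?thesis unfolding complete_homogeneous_def by (simp only: sum.empty)
qed

text \<open>In a sorted list the last entry is the largest, so the index lists split by whether they
  end in \<open>Suc c\<close>. Deleting that entry leaves an arbitrary sorted list of length
  \<open>f\<close> over the same indices.\<close>

lemma complete_homogeneous_Suc_Suc:
  "complete_homogeneous (Suc c) (Suc f) X =
     complete_homogeneous c (Suc f) X + X (Suc c) * complete_homogeneous (Suc c) f X"
proof -
  define S where "S = (\<lambda>c f. {is :: nat list. length is = f \<and> sorted is \<and> set is \<subseteq> {1..c}})"
  have fin: "finite (S c f)" for c f
  proof (rule finite_subset)
    show "S c f \<subseteq> {is. set is \<subseteq> {1..c} \<and> length is = f}" by (auto simp: S_def)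
  qed (rule finite_lists_length_eq, simp)
  have split: "S (Suc c) (Suc f) = S c (Suc f) \<union> (\<lambda>is. is @ [Suc c]) ` S (Suc c) f"
  proof (intro equalityI subsetI)
    fix js assume js: "js \<in> S (Suc c) (Suc f)"
    then obtain ks k where ksk: "js = ks @ [k]"
      by (cases js rule: rev_cases) (auto simp: S_def)
    show "js \<in> S c (Suc f) \<union> (\<lambda>is. is @ [Suc c]) ` S (Suc c) f"
    proof (cases "k = Suc c")
      case True
      then show ?thesis using js ksk by (auto simp: S_def sorted_append)
    next
      case False
      then have "k \<le> c" using js ksk by (auto simp: S_def)
      then have "js \<in> S c (Suc f)" using js ksk by (fastforce simp: S_def sorted_append)
      then show ?thesis by simp
    qed
  next
    fix js assume "js \<in> S c (Suc f) \<union> (\<lambda>is. is @ [Suc c]) ` S (Suc c) f"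
    then show "js \<in> S (Suc c) (Suc f)" by (fastforce simp: S_def sorted_append)
  qed
  have disj: "S c (Suc f) \<inter> (\<lambda>is. is @ [Suc c]) ` S (Suc c) f = {}"
    by (auto simp: S_def)
  have last: "(\<Prod>l<Suc f. X ((js @ [Suc c]) ! l)) = X (Suc c) * (\<Prod>l<f. X (js ! l))"
    if "js \<in> S (Suc c) f" for js
  proof -
    have len: "length js = f" using that by (simp add: S_def)
    have "(\<Prod>l<f. X ((js @ [Suc c]) ! l)) = (\<Prod>l<f. X (js ! l))"
      by (rule prod.cong) (auto simp: nth_append len)
    moreover have "(js @ [Suc c]) ! f = Suc c" using len by (metis nth_append_length)
    ultimately show ?thesis by (simp add: mult.commute)
  qed
  have h: "complete_homogeneous c f X = (\<Sum>is\<in>S c f. \<Prod>l<f. X (is ! l))" for c f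
    by (simp add: complete_homogeneous_def S_def)
  have "complete_homogeneous (Suc c) (Suc f) X = complete_homogeneous c (Suc f) X +
      (\<Sum>js\<in>(\<lambda>is. is @ [Suc c]) ` S (Suc c) f. \<Prod>l<Suc f. X (js ! l))"
    unfolding h split by (intro sum.union_disjoint disj fin finite_imageI)
  also have "(\<Sum>js\<in>(\<lambda>is. is @ [Suc c]) ` S (Suc c) f. \<Prod>l<Suc f. X (js ! l)) =
      (\<Sum>is\<in>S (Suc c) f. \<Prod>l<Suc f. X ((is @ [Suc c]) ! l))"
    by (subst sum.reindex) (auto simp: inj_on_def)
  also have "\<dots> = X (Suc c) * complete_homogeneous (Suc c) f X"
    unfolding h sum_distrib_left by (intro sum.cong refl last)
  finally show ?thesis .
qed

text \<open>Both sides have degree below \<open>card I\<close> and agree at the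
  \<open>card I\<close> distinct nodes. As a polynomial identity it can later be evaluated at a
  point and also compared in its top coefficient.\<close>

lemma lagrange_interpolation_power:
  fixes X :: "'i \<Rightarrow> 'a :: field"
  assumes fin: "finite I" and inj: "inj_on X I" and n: "n < card I"
  shows "(\<Sum>l\<in>I. smult (X l ^ n / (\<Prod>k\<in>I - {l}. X l - X k)) (\<Prod>k\<in>I - {l}. [:- X k, 1:])) = monom 1 n"
    (is "?L = _")
proof (rule poly_eqI_degree[where A = "X ` I"])
  have deg: "degree (\<Prod>k\<in>I - {l}. [:- X k, 1:]) = card I - 1" if "l \<in> I" for l
    using that fin by (simp add: degree_prod_eq_sum_degree)
  show "card (X ` I) > degree ?L"
  proof -
    have "degree ?L \<le> card I - 1"
      using deg fin by (intro degree_sum_le) (auto intro: order_trans[OF degree_smult_le])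
    then show ?thesis using n by (simp add: card_image[OF inj])
  qed
  show "card (X ` I) > degree (monom (1 :: 'a) n)"
    using n by (simp add: card_image[OF inj] degree_monom_eq)
  fix x assume "x \<in> X ` I"
  then obtain i where i: "i \<in> I" "x = X i" by auto
  have "poly ?L x = (\<Sum>l\<in>I. if l = i then X i ^ n else 0)"
    unfolding poly_sum
  proof (intro sum.cong refl)
    fix l assume l: "l \<in> I"
    have "(\<Prod>k\<in>I - {i}. X i - X k) \<noteq> 0"
      using fin inj i by (auto simp: inj_on_def)
    moreover have "(\<Prod>k\<in>I - {l}. X i - X k) = 0" if "l \<noteq> i"
      using fin that i by (intro prod_zero) auto
    ultimately show "poly (smult (X l ^ n / (\<Prod>k\<in>I - {l}. X l - X k)) (\<Prod>k\<in>I - {l}. [:- X k, 1:])) x =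
        (if l = i then X i ^ n else 0)"
      by (auto simp: poly_prod i)
  qed
  then show "poly ?L x = poly (monom 1 n) x"
    using fin i by (simp add: poly_monom)
qed

text \<open>The sum is the divided difference of the power \<open>n\<close> at the nodes. It is the
  coefficient of degree \<open>card I - 1\<close> in the Lagrange identity, because each basis
  product is monic of that degree.\<close>

lemma sum_power_over_differences:
  fixes X :: "'i \<Rightarrow> 'a :: field"
  assumes fin: "finite I" and inj: "inj_on X I" and n: "n < card I"
  shows "(\<Sum>l\<in>I. X l ^ n / (\<Prod>k\<in>I - {l}. X l - X k)) = (if Suc n = card I then 1 else 0)"
proof -
  have "coeff (\<Prod>k\<in>I - {l}. [:- X k, 1:]) (card I - 1) = 1" if "l \<in> I" for l
  proof -
    have "degree (\<Prod>k\<in>I - {l}. [:- X k, 1:]) = card I - 1"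
      using that fin by (simp add: degree_prod_eq_sum_degree)
    moreover have "lead_coeff (\<Prod>k\<in>I - {l}. [:- X k, 1:]) = 1"
      by (simp add: lead_coeff_prod)
    ultimately show ?thesis by simp
  qed
  then have "(\<Sum>l\<in>I. X l ^ n / (\<Prod>k\<in>I - {l}. X l - X k)) =
      coeff (\<Sum>l\<in>I. smult (X l ^ n / (\<Prod>k\<in>I - {l}. X l - X k)) (\<Prod>k\<in>I - {l}. [:- X k, 1:])) (card I - 1)"
    by (simp add: coeff_sum)
  also have "\<dots> = coeff (monom 1 n) (card I - 1)"
    by (simp only: lagrange_interpolation_power[OF assms])
  finally show ?thesis using n by auto
qed

text \<open>The divided differences \<open>D c n\<close> obey the same recursion in the last
  variable as the complete homogeneous polynomials, whence a double induction on \<open>c\<close>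
  and \<open>f\<close>. Degree 0 is left out because for \<open>c = 0\<close> the polynomial is 1
  while the sum is empty.\<close>

lemma complete_homogeneous_eq_sum:
  fixes X :: "nat \<Rightarrow> 'a :: field"
  assumes inj: "inj_on X {1..c}"
  shows "complete_homogeneous c (Suc f) X =
     (\<Sum>l = 1..c. X l ^ (c + f) / (\<Prod>k\<in>{1..c} - {l}. X l - X k))"
  using inj
proof (induction c arbitrary: f)
  case (Suc c)
  define D where "D = (\<lambda>c n. \<Sum>l = 1..c. X l ^ n / (\<Prod>k\<in>{1..c} - {l}. X l - X k))"
  have inj': "inj_on X {1..c}" using Suc.prems by (rule inj_on_subset) auto
  have IH: "complete_homogeneous c (Suc f) X = D c (c + f)" for f
    unfolding D_def by (rule Suc.IH[OF inj'])
  have D_step: "D (Suc c) (Suc n) = D c n + X (Suc c) * D (Suc c) n" for n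
  proof -
    \<comment> \<open>The factor \<open>X l - X (Suc c)\<close> kills the summand for
      \<open>Suc c\<close> and cancels one factor of every other denominator.\<close>
    have "D (Suc c) (Suc n) - X (Suc c) * D (Suc c) n =
        (\<Sum>l = 1..Suc c. (X l - X (Suc c)) * (X l ^ n / (\<Prod>k\<in>{1..Suc c} - {l}. X l - X k)))"
      unfolding D_def sum_distrib_left sum_subtractf[symmetric]
      by (intro sum.cong refl) (simp add: algebra_simps diff_divide_distrib)
    also have "\<dots> = (\<Sum>l = 1..c. (X l - X (Suc c)) * (X l ^ n / (\<Prod>k\<in>{1..Suc c} - {l}. X l - X k)))"
      by simp
    also have "\<dots> = D c n"
      unfolding D_def
    proof (intro sum.cong refl)
      fix l assume l: "l \<in> {1..c}"
      have "{1..Suc c} - {l} = insert (Suc c) ({1..c} - {l})" using l by auto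
      then have "(\<Prod>k\<in>{1..Suc c} - {l}. X l - X k) =
          (X l - X (Suc c)) * (\<Prod>k\<in>{1..c} - {l}. X l - X k)" by simp
      moreover have "X l - X (Suc c) \<noteq> 0"
        using inj_onD[OF Suc.prems, of l "Suc c"] l by auto
      ultimately show "(X l - X (Suc c)) * (X l ^ n / (\<Prod>k\<in>{1..Suc c} - {l}. X l - X k)) =
          X l ^ n / (\<Prod>k\<in>{1..c} - {l}. X l - X k)" by simp
    qed
    finally show ?thesis by (simp add: algebra_simps)
  qed
  have "complete_homogeneous (Suc c) (Suc f) X = D (Suc c) (Suc c + f)"
  proof (induction f)
    case 0
    \<comment> \<open>The exponent is one less than the number of nodes, so this divided difference
      matches the polynomial of degree 0.\<close>
    have "D (Suc c) c = 1"
      unfolding D_def using sum_power_over_differences[OF _ Suc.prems, of c] by simp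
    then show ?case
      using D_step[of c] by (simp add: complete_homogeneous_Suc_Suc IH)
  next
    case (Suc f)
    then show ?case
      using D_step[of "c + Suc f"] by (simp add: complete_homogeneous_Suc_Suc IH)
  qed
  then show ?case by (simp add: D_def)
qed simp

text \<open>The pairs avoiding \<open>l\<close>, together with a sign, form \<open>R\<close>. As
  \<open>R\<close> does not depend on \<open>y\<close>, the choice \<open>y = X l\<close> gives
  \<open>diff_prod c X\<close> with the same factor, which then cancels in quotients.\<close>

lemma diff_prod_upd:
  fixes X :: "nat \<Rightarrow> 'a :: comm_ring_1"
  assumes l: "l \<in> {1..c}"
  obtains R where "\<And>y. diff_prod c (X(l := y)) = R * (\<Prod>k\<in>{1..c} - {l}. y - X k)"
proof
  fix y
  define P where "P = {(i, k). 1 \<le> i \<and> i < k \<and> k \<le> c}"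
  define N where "N = {(i, k). 1 \<le> i \<and> i < k \<and> k \<le> c \<and> i \<noteq> l \<and> k \<noteq> l}"
  define Y where "Y = X(l := y)"
  have Y: "Y l = y" "\<And>i. i \<noteq> l \<Longrightarrow> Y i = X i" by (simp_all add: Y_def)
  have P: "P = N \<union> ((\<lambda>i. (i, l)) ` {1..<l} \<union> Pair l ` {l<..c})"
    using l by (auto simp: P_def N_def)
  have fin: "finite N" by (rule finite_subset[of _ "{1..c} \<times> {1..c}"]) (auto simp: N_def)
  have "diff_prod c Y = (\<Prod>(i, k)\<in>N. Y i - Y k) *
      ((\<Prod>(i, k)\<in>(\<lambda>i. (i, l)) ` {1..<l}. Y i - Y k) * (\<Prod>(i, k)\<in>Pair l ` {l<..c}. Y i - Y k))"
    unfolding diff_prod_def P_def[symmetric] P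
    by (subst prod.union_disjoint prod.union_disjoint, use fin in \<open>auto simp: N_def\<close>)+
  also have "(\<Prod>(i, k)\<in>N. Y i - Y k) = (\<Prod>(i, k)\<in>N. X i - X k)"
    by (rule prod.cong) (auto simp: N_def Y)
  \<comment> \<open>With \<open>l\<close> in second position the difference is
    \<open>X i - y\<close>; reversing all \<open>l - 1\<close> of these produces the sign.\<close>
  also have "(\<Prod>(i, k)\<in>(\<lambda>i. (i, l)) ` {1..<l}. Y i - Y k) = (\<Prod>i\<in>{1..<l}. (- 1) * (y - X i))"
    by (subst prod.reindex) (auto simp: inj_on_def Y intro!: prod.cong)
  also have "\<dots> = (- 1) ^ (l - 1) * (\<Prod>k\<in>{1..<l}. y - X k)"
    by (simp only: prod.distrib) simp
  also have "(\<Prod>(i, k)\<in>Pair l ` {l<..c}. Y i - Y k) = (\<Prod>k\<in>{l<..c}. y - X k)"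
    by (subst prod.reindex) (auto simp: inj_on_def Y intro!: prod.cong)
  also have "(\<Prod>(i, k)\<in>N. X i - X k) * ((- 1) ^ (l - 1) * (\<Prod>k\<in>{1..<l}. y - X k) * (\<Prod>k\<in>{l<..c}. y - X k)) =
      (\<Prod>(i, k)\<in>N. X i - X k) * (- 1) ^ (l - 1) * ((\<Prod>k\<in>{1..<l}. y - X k) * (\<Prod>k\<in>{l<..c}. y - X k))"
    by (simp add: mult_ac)
  also have "(\<Prod>k\<in>{1..<l}. y - X k) * (\<Prod>k\<in>{l<..c}. y - X k) = (\<Prod>k\<in>{1..<l} \<union> {l<..c}. y - X k)"
    by (rule prod.union_disjoint[symmetric]) auto
  also have "{1..<l} \<union> {l<..c} = {1..c} - {l}" using l by auto
  finally show "diff_prod c (X(l := y)) =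
      (\<Prod>(i, k)\<in>{(i, k). 1 \<le> i \<and> i < k \<and> k \<le> c \<and> i \<noteq> l \<and> k \<noteq> l}. X i - X k) * (- 1) ^ (l - 1) *
      (\<Prod>k\<in>{1..c} - {l}. y - X k)"
    unfolding Y_def N_def .
qed

text \<open>After cancelling the common factor, nonzero for distinct nodes, the Lagrange basis
  polynomial of the node \<open>X l\<close> at \<open>y\<close> remains.\<close>

lemma diff_prod_ratio:
  fixes X :: "nat \<Rightarrow> 'a :: field"
  assumes l: "l \<in> {1..c}" and inj: "inj_on X {1..c}"
  shows "diff_prod c (X(l := y)) / diff_prod c X =
     (\<Prod>k\<in>{1..c} - {l}. y - X k) / (\<Prod>k\<in>{1..c} - {l}. X l - X k)"
proof -
  obtain R where R: "\<And>y. diff_prod c (X(l := y)) = R * (\<Prod>k\<in>{1..c} - {l}. y - X k)"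
    using diff_prod_upd[OF l] by blast
  have "diff_prod c X \<noteq> 0"
    unfolding diff_prod_def
  proof (subst prod_zero_iff)
    show "finite {(i, k). 1 \<le> i \<and> i < k \<and> k \<le> c}"
      by (rule finite_subset[of _ "{1..c} \<times> {1..c}"]) auto
    show "\<not> (\<exists>p\<in>{(i, k). 1 \<le> i \<and> i < k \<and> k \<le> c}. (case p of (i, k) \<Rightarrow> X i - X k) = 0)"
      using inj_onD[OF inj] by fastforce
  qed
  moreover have "diff_prod c X = R * (\<Prod>k\<in>{1..c} - {l}. X l - X k)"
    using R[of "X l"] by simp
  ultimately show ?thesis by (simp add: R)
qed

text \<open>Interpolation of a power below \<open>c\<close> through \<open>c\<close> nodes is exact.
  The case \<open>y = 1\<close> serves both the telescoping below and the vanishing boundary values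
  in the kernel method.\<close>

lemma sum_diff_prod_ratio_power:
  fixes X :: "nat \<Rightarrow> 'a :: field"
  assumes inj: "inj_on X {1..c}" and n: "n < c"
  shows "(\<Sum>l = 1..c. diff_prod c (X(l := y)) / diff_prod c X * X l ^ n) = y ^ n"
proof -
  have "(\<Sum>l = 1..c. diff_prod c (X(l := y)) / diff_prod c X * X l ^ n) =
      poly (\<Sum>l = 1..c. smult (X l ^ n / (\<Prod>k\<in>{1..c} - {l}. X l - X k)) (\<Prod>k\<in>{1..c} - {l}. [:- X k, 1:])) y"
    unfolding poly_sum using inj
    by (intro sum.cong refl) (simp add: diff_prod_ratio poly_prod)
  also have "\<dots> = poly (monom 1 n) y"
    using n by (subst lagrange_interpolation_power[OF _ inj]) simp_all
  finally show ?thesis by (simp add: poly_monom)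
qed

text \<open>By \<open>A\<close>, multiplying the divided-difference formula for degree
  \<open>f\<close> by \<open>\<Prod>k = 1..c. 1 - X k\<close> turns it into a difference of sums
  with exponents \<open>c - 1 + f\<close> and \<open>c + f\<close>. Summing over \<open>f\<close>
  telescopes, and the initial sum, with exponent \<open>c - 1\<close>, is 1.\<close>

lemma sum_complete_homogeneous:
  fixes X :: "nat \<Rightarrow> 'a :: field"
  assumes inj: "inj_on X {1..c}" and c: "c \<ge> 1"
  shows "1 - (\<Sum>l = 1..c. diff_prod c (X(l := 1)) / diff_prod c X * X l ^ (c + j)) =
     (\<Sum>f = 0..j. complete_homogeneous c f X) * (\<Prod>l = 1..c. 1 - X l)"
proof -
  define A where "A = (\<lambda>l. diff_prod c (X(l := 1)) / diff_prod c X)"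
  define V where "V = (\<lambda>l. \<Prod>k\<in>{1..c} - {l}. X l - X k)"
  have A: "A l * (1 - X l) = (\<Prod>k = 1..c. 1 - X k) / V l" if "l \<in> {1..c}" for l
  proof -
    have "(\<Prod>k = 1..c. 1 - X k) = (1 - X l) * (\<Prod>k\<in>{1..c} - {l}. 1 - X k)"
      using that by (intro prod.remove) auto
    then show ?thesis
      unfolding A_def V_def diff_prod_ratio[OF that inj] by (simp add: mult.commute)
  qed
  have h: "complete_homogeneous c f X = (\<Sum>l = 1..c. X l ^ (c - 1 + f) / V l)" for f
  proof (cases f)
    case 0
    then show ?thesis
      using sum_power_over_differences[OF _ inj, of "c - 1"] c by (simp add: V_def)
  next
    case (Suc f')
    then show ?thesis
      using complete_homogeneous_eq_sum[OF inj, of f'] c by (simp add: V_def)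
  qed
  have step: "complete_homogeneous c f X * (\<Prod>k = 1..c. 1 - X k) =
      (\<Sum>l = 1..c. A l * X l ^ (c - 1 + f)) - (\<Sum>l = 1..c. A l * X l ^ (c + f))" for f
  proof -
    have "complete_homogeneous c f X * (\<Prod>k = 1..c. 1 - X k) =
        (\<Sum>l = 1..c. A l * (1 - X l) * X l ^ (c - 1 + f))"
      unfolding h sum_distrib_right by (intro sum.cong refl) (simp add: A)
    also have "\<dots> = (\<Sum>l = 1..c. A l * X l ^ (c - 1 + f) - A l * X l ^ (c + f))"
    proof (intro sum.cong refl)
      fix l
      have "X l ^ (c + f) = X l * X l ^ (c - 1 + f)"
        using c by (simp flip: power_Suc)
      then show "A l * (1 - X l) * X l ^ (c - 1 + f) = A l * X l ^ (c - 1 + f) - A l * X l ^ (c + f)"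
        by (simp add: algebra_simps)
    qed
    finally show ?thesis by (simp only: sum_subtractf)
  qed
  have "(\<Sum>f = 0..j. complete_homogeneous c f X) * (\<Prod>l = 1..c. 1 - X l) =
      (\<Sum>l = 1..c. A l * X l ^ (c - 1)) - (\<Sum>l = 1..c. A l * X l ^ (c + j))"
  proof (induction j)
    case 0
    show ?case using step[of 0] by simp
  next
    case (Suc j)
    then show ?case using step[of "Suc j"] c by (simp add: distrib_right)
  qed
  moreover have "(\<Sum>l = 1..c. A l * X l ^ (c - 1)) = 1"
    unfolding A_def using sum_diff_prod_ratio_power[OF inj, of "c - 1" 1] c by simp
  ultimately show ?thesis by (simp add: A_def)
qed

section \<open>First-step decomposition of meanders\<close>

lemma meanders_0: "meanders m b 0 j = {[(0, int j)]}"
  by (auto simp: meanders_def length_Suc_conv)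

text \<open>Dropping the first point and translating the rest back by one unit of length gives a
  meander from the level reached by the first step. The side condition keeps that level nonnegative,
  so that \<open>nat\<close> is exact.\<close>

lemma meanders_Suc:
  "meanders m b (Suc n) j = (\<Union>l\<in>{l\<in>{1..m}. int j + b l \<ge> 0}.
     (\<lambda>q. (0, int j) # map ((+) (1, 0)) q) ` meanders m b n (nat (int j + b l)))"
    (is "_ = (\<Union>l\<in>?L. ?f ` ?M l)")
proof (intro equalityI subsetI)
  fix p assume p: "p \<in> meanders m b (Suc n) j"
  define q where "q = map (\<lambda>x. x - (1, 0)) (tl p)"
  have len: "length p = n + 2" and p0: "p ! 0 = (0, int j)"
    and pos: "\<And>i. i \<le> Suc n \<Longrightarrow> snd (p ! i) \<ge> 0"
    and step: "\<And>i. i \<in> {1..Suc n} \<Longrightarrow> p ! i - p ! (i - 1) \<in> step_set m b"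
    using p by (auto simp: meanders_def)
  have q: "length q = n + 1" "\<And>i. i \<le> n \<Longrightarrow> q ! i = p ! Suc i - (1, 0)"
    using len by (auto simp: q_def nth_tl)
  obtain l where l: "l \<in> {1..m}" "p ! 1 - p ! 0 = (1, b l)"
    using step[of 1] by (auto simp: step_set_def)
  then have p1: "p ! 1 = (1, int j + b l)" using p0 by (cases "p ! 1") auto
  have lj: "int j + b l \<ge> 0" using pos[of 1] p1 by simp
  have "q \<in> ?M l"
    unfolding meanders_def mem_Collect_eq
  proof (intro conjI ballI)
    show "length q = n + 1" by fact
    show "q ! 0 = (0, int (nat (int j + b l)))" using q(2)[of 0] p1 lj by simp
    show "q ! i - q ! (i - 1) \<in> step_set m b" if "i \<in> {1..n}" for i
      using that q(2)[of i] q(2)[of "i - 1"] step[of "Suc i"] by auto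
    show "snd (q ! i) \<ge> 0" if "i \<in> {0..n}" for i
      using that q(2)[of i] pos[of "Suc i"] by auto
  qed
  moreover have "p = ?f q"
  proof -
    have "p = (0, int j) # tl p" using len p0 by (cases p) auto
    then show ?thesis by (simp add: q_def comp_def)
  qed
  ultimately show "p \<in> (\<Union>l\<in>?L. ?f ` ?M l)" using l lj by blast
next
  fix p assume "p \<in> (\<Union>l\<in>?L. ?f ` ?M l)"
  then obtain l q where l: "l \<in> {1..m}" "int j + b l \<ge> 0" and q: "q \<in> ?M l" and p: "p = ?f q"
    by auto
  have nth: "p ! Suc i = (1, 0) + q ! i" if "i \<le> n" for i
    using that q by (simp add: p meanders_def)
  show "p \<in> meanders m b (Suc n) j"
    unfolding meanders_def mem_Collect_eq
  proof (intro conjI ballI)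
    show "length p = Suc n + 1" "p ! 0 = (0, int j)" using q by (simp_all add: p meanders_def)
    show "p ! i - p ! (i - 1) \<in> step_set m b" if "i \<in> {1..Suc n}" for i
    proof (cases "i = 1")
      case True
      then show ?thesis using nth[of 0] q l by (auto simp: p meanders_def step_set_def)
    next
      case False
      \<comment> \<open>The path \<open>p\<close> has one point more than \<open>q\<close>, so for
        \<open>i \<ge> 2\<close> its step into point \<open>i\<close> is the step of
        \<open>q\<close> from \<open>k\<close> to \<open>Suc k\<close>; the translation cancels in
        the difference.\<close>
      define k where "k = i - 2"
      have k: "i = Suc (Suc k)" using False that by (auto simp: k_def)
      then have "p ! i - p ! (i - 1) = q ! Suc k - q ! k"
        using that nth[of "Suc k"] nth[of k] by simp
      moreover have "q ! Suc k - q ! k \<in> step_set m b"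
      proof -
        have "\<forall>i\<in>{1..n}. q ! i - q ! (i - 1) \<in> step_set m b" using q by (simp add: meanders_def)
        moreover have "Suc k \<in> {1..n}" using that k by simp
        ultimately show ?thesis by fastforce
      qed
      ultimately show ?thesis by simp
    qed
    show "snd (p ! i) \<ge> 0" if "i \<in> {0..Suc n}" for i
    proof (cases i)
      case (Suc k)
      then show ?thesis using that nth[of k] q by (auto simp: meanders_def)
    qed (simp add: p)
  qed
qed

lemma step_weight_step:
  assumes "inj_on b {1..m}" "l \<in> {1..m}"
  shows "step_weight m b w (1, b l) = w l"
proof -
  have "inj_on (\<lambda>l. (1 :: int, b l)) {1..m}" using inj_onD[OF assms(1)] by (intro inj_onI) simp
  from the_inv_into_f_f[OF this assms(2)] show ?thesis by (simp add: step_weight_def)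
qed

text \<open>Weights depend only on differences of consecutive points, so the translation is harmless
  and just the factor of the first step is new.\<close>

lemma path_weight_prepend:
  assumes "inj_on b {1..m}" "l \<in> {1..m}" "int j + b l \<ge> 0"
    and q: "q \<in> meanders m b n (nat (int j + b l))"
  shows "path_weight m b w ((0, int j) # map ((+) (1, 0)) q) = w l * path_weight m b w q"
proof -
  let ?p = "(0, int j) # map ((+) (1, 0)) q"
  have len: "length q = Suc n" and q0: "q ! 0 = (0, int j + b l)"
    using q assms(3) by (auto simp: meanders_def)
  have "path_weight m b w ?p = (\<Prod>i = 1..<Suc (Suc n). step_weight m b w (?p ! i - ?p ! (i - 1)))"
    by (simp add: path_weight_def len)
  also have "\<dots> = (\<Prod>i = 0..<Suc n. step_weight m b w (?p ! Suc i - ?p ! i))"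
    using prod.shift_bounds_Suc_ivl[of "\<lambda>i. step_weight m b w (?p ! i - ?p ! (i - 1))" 0 "Suc n"]
    by simp
  also have "\<dots> = step_weight m b w (?p ! Suc 0 - ?p ! 0) *
      (\<Prod>i = 1..<Suc n. step_weight m b w (?p ! Suc i - ?p ! i))"
    by (simp add: prod.atLeast_Suc_lessThan del: prod.op_ivl_Suc)
  also have "?p ! Suc 0 - ?p ! 0 = (1, b l)" using len q0 by simp
  also have "(\<Prod>i = 1..<Suc n. step_weight m b w (?p ! Suc i - ?p ! i)) = path_weight m b w q"
    unfolding path_weight_def len
  proof (intro prod.cong refl)
    fix i assume "i \<in> {1..<Suc n}"
    then have "?p ! Suc i - ?p ! i = q ! i - q ! (i - 1)"
      using len by (cases i) auto
    then show "step_weight m b w (?p ! Suc i - ?p ! i) = step_weight m b w (q ! i - q ! (i - 1))"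
      by simp
  qed
  finally show ?thesis using step_weight_step[OF assms(1,2)] by simp
qed

lemma meander_total_0: "meander_total m b w 0 j = 1"
  by (simp add: meander_total_def meanders_0 path_weight_def)

text \<open>The pieces of the first-step decomposition are disjoint: distinct \<open>b l\<close>
  lead to distinct nonnegative levels, so the tails start at different points.\<close>

lemma meander_total_Suc:
  assumes inj: "inj_on b {1..m}"
  shows "meander_total m b w (Suc n) j =
    (\<Sum>l = 1..m. if int j + b l \<ge> 0 then w l * meander_total m b w n (nat (int j + b l)) else 0)"
proof -
  let ?f = "\<lambda>q. (0 :: int, int j) # map ((+) (1, 0)) q" and ?L = "{l\<in>{1..m}. int j + b l \<ge> 0}"
  let ?M = "\<lambda>l. meanders m b n (nat (int j + b l))"
  have inj_f: "inj ?f" by (intro injI) (simp add: inj_map_eq_map[OF inj_on_add])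
  have disj: "?f ` ?M l \<inter> ?f ` ?M l' = {}" if "l \<in> ?L" "l' \<in> ?L" "l \<noteq> l'" for l l'
  proof -
    have "b l \<noteq> b l'" using that inj_onD[OF inj, of l l'] by auto
    then have "?M l \<inter> ?M l' = {}" using that by (auto simp: meanders_def)
    then show ?thesis by (simp add: image_Int[OF inj_f, symmetric])
  qed
  have "meander_total m b w (Suc n) j = (\<Sum>l\<in>?L. \<Sum>p\<in>?f ` ?M l. path_weight m b w p)"
    unfolding meander_total_def meanders_Suc
    using disj by (intro sum.UNION_disjoint) (auto intro!: finite_meanders)
  also have "\<dots> = (\<Sum>l\<in>?L. w l * meander_total m b w n (nat (int j + b l)))"
  proof (intro sum.cong refl)
    fix l assume l: "l \<in> ?L"
    have "(\<Sum>p\<in>?f ` ?M l. path_weight m b w p) = (\<Sum>q\<in>?M l. path_weight m b w (?f q))"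
      using inj_on_subset[OF inj_f subset_UNIV] by (subst sum.reindex) simp_all
    also have "\<dots> = (\<Sum>q\<in>?M l. w l * path_weight m b w q)"
      using l inj by (intro sum.cong refl path_weight_prepend) auto
    finally show "(\<Sum>p\<in>?f ` ?M l. path_weight m b w p) = w l * meander_total m b w n (nat (int j + b l))"
      by (simp add: meander_total_def sum_distrib_left)
  qed
  finally show ?thesis by (simp only: sum.inter_filter[OF finite_atLeastAtMost])
qed

lemma meander_gf_rec:
  assumes "inj_on b {1..m}"
  shows "meander_gf m b w j = 1 + fps_X * (\<Sum>l = 1..m. if int j + b l \<ge> 0
     then fps_const (complex_of_real (w l)) * meander_gf m b w (nat (int j + b l)) else 0)"
proof (rule fps_ext)
  fix n
  show "fps_nth (meander_gf m b w j) n = fps_nth (1 + fps_X * (\<Sum>l = 1..m. if int j + b l \<ge> 0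
      then fps_const (complex_of_real (w l)) * meander_gf m b w (nat (int j + b l)) else 0)) n"
    by (cases n) (auto simp: meander_gf_def meander_total_0 meander_total_Suc[OF assms] fps_sum_nth
        intro!: sum.cong)
qed

section \<open>Arithmetic and valuation of Puiseux series\<close>

definition puiseux_order_ge :: "rat \<Rightarrow> 'a :: field puiseux \<Rightarrow> bool" where
  "puiseux_order_ge r X \<longleftrightarrow> X = 0 \<or> r \<le> puiseux_order X"

lemma puiseux_order_ge_root:
  "n > 0 \<Longrightarrow> puiseux_order_ge r (puiseux_root n f) \<longleftrightarrow> f = 0 \<or> r * of_nat n \<le> of_int (fls_subdegree f)"
  by (simp add: puiseux_order_ge_def puiseux_zero_root puiseux_root_inject puiseux_order_root
      field_simps)

lemma puiseux_order_ge_mono: "puiseux_order_ge r X \<Longrightarrow> s \<le> r \<Longrightarrow> puiseux_order_ge s X"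
  by (auto simp: puiseux_order_ge_def)

lemma puiseux_order_ge_0 [simp]: "puiseux_order_ge r 0"
  by (simp add: puiseux_order_ge_def)

lemma puiseux_order_ge_1: "puiseux_order_ge 0 1"
  by (simp add: one_puiseux_def puiseux_order_ge_root)

lemma puiseux_order_ge_add:
  assumes "puiseux_order_ge r X" "puiseux_order_ge r Y"
  shows "puiseux_order_ge r (X + Y)"
proof -
  obtain n f g where n: "n > 0" and X: "X = puiseux_root n f" and Y: "Y = puiseux_root n g"
    by (rule puiseux_cases2)
  have "f + g = 0 \<or> r * of_nat n \<le> of_int (fls_subdegree (f + g))"
  proof (cases "f = 0 \<or> g = 0 \<or> f + g = 0")
    case False
    then have "fls_subdegree (f + g) \<ge> min (fls_subdegree f) (fls_subdegree g)"
      by (intro fls_plus_subdegree) auto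
    moreover have "r * of_nat n \<le> of_int (min (fls_subdegree f) (fls_subdegree g))"
      using assms False n by (simp add: X Y puiseux_order_ge_root min_def)
    ultimately show ?thesis by (meson of_int_le_iff order_trans)
  qed (use assms n in \<open>auto simp: X Y puiseux_order_ge_root\<close>)
  then show ?thesis using n by (simp add: X Y puiseux_arith_root puiseux_order_ge_root)
qed

lemma puiseux_order_ge_sum:
  "(\<And>i. i \<in> I \<Longrightarrow> puiseux_order_ge r (X i)) \<Longrightarrow> puiseux_order_ge r (\<Sum>i\<in>I. X i)"
  by (induction I rule: infinite_finite_induct) (auto intro: puiseux_order_ge_add)

lemma puiseux_order_ge_mult:
  assumes "puiseux_order_ge r X" "puiseux_order_ge s Y"
  shows "puiseux_order_ge (r + s) (X * Y)"
proof -
  obtain n f g where n: "n > 0" and X: "X = puiseux_root n f" and Y: "Y = puiseux_root n g"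
    by (rule puiseux_cases2)
  show ?thesis
  proof (cases "f = 0 \<or> g = 0")
    case False
    then show ?thesis
      using assms n by (simp add: X Y puiseux_arith_root puiseux_order_ge_root distrib_right)
  qed (use n in \<open>auto simp: X Y puiseux_arith_root puiseux_order_ge_root\<close>)
qed

lemma puiseux_order_ge_power:
  "puiseux_order_ge 0 X \<Longrightarrow> puiseux_order_ge 0 (X ^ k)"
  using puiseux_order_ge_mult[of 0 _ 0] by (induction k) (auto simp: puiseux_order_ge_1)

lemma puiseux_order_ge_diff:
  assumes "puiseux_order_ge r X" "puiseux_order_ge r Y"
  shows "puiseux_order_ge r (X - Y)"
proof -
  obtain n g where n: "n > 0" and Y: "Y = puiseux_root n g"
    by (rule puiseux_cases)
  have "puiseux_order_ge r (- Y)"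
    using assms(2) n by (simp add: Y puiseux_arith_root puiseux_order_ge_root)
  then show ?thesis
    using puiseux_order_ge_add[OF assms(1)] by fastforce
qed

lemma puiseux_order_ge_fps: "puiseux_order_ge 0 (puiseux_of_fps f)"
  by (simp add: puiseux_of_fps_def puiseux_order_ge_root fls_subdegree_fls_to_fps)

lemma puiseux_order_ge_z: "puiseux_order_ge 1 puiseux_z"
  by (simp add: puiseux_of_fps_def puiseux_order_ge_root)

text \<open>A nonzero series has a finite order, which some \<open>r + of_nat n\<close>
  exceeds.\<close>

lemma puiseux_order_ge_imp_zero:
  assumes "\<And>n. puiseux_order_ge (r + of_nat n) X"
  shows "X = 0"
proof (rule ccontr)
  assume "X \<noteq> 0"
  then have "r + of_nat n \<le> puiseux_order X" for n
    using assms[of n] by (simp add: puiseux_order_ge_def)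
  moreover obtain n where "puiseux_order X - r < of_nat n"
    using reals_Archimedean2 by blast
  ultimately show False by (metis add.commute less_diff_eq not_le diff_less_eq)
qed

lemma puiseux_of_fps_arith:
  "puiseux_of_fps 0 = 0" "puiseux_of_fps 1 = 1"
  "puiseux_of_fps (f + g) = puiseux_of_fps f + puiseux_of_fps g"
  "puiseux_of_fps (f * g) = puiseux_of_fps f * puiseux_of_fps g"
  by (simp_all add: puiseux_of_fps_def zero_puiseux_def one_puiseux_def puiseux_arith_root
      fls_times_fps_to_fls)

lemma puiseux_of_fps_sum: "puiseux_of_fps (\<Sum>i\<in>I. f i) = (\<Sum>i\<in>I. puiseux_of_fps (f i))"
  by (induction I rule: infinite_finite_induct) (simp_all add: puiseux_of_fps_arith)

lemma puiseux_of_fps_inject: "puiseux_of_fps f = puiseux_of_fps g \<longleftrightarrow> f = g"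
  by (simp add: puiseux_of_fps_def puiseux_root_inject)

section \<open>The kernel method\<close>

text \<open>The induction gains one unit of order per use of the recurrence. It needs the bound at
  all levels reached by a step, so \<open>r\<close> must not depend on \<open>j\<close>.\<close>

lemma meander_recurrence_unique:
  fixes D :: "nat \<Rightarrow> complex puiseux"
  assumes rec: "\<And>j. D j = puiseux_z * (\<Sum>l = 1..m. if int j + b l \<ge> 0
      then puiseux_const (v l) * D (nat (int j + b l)) else 0)"
    and bound: "\<And>j. puiseux_order_ge r (D j)"
  shows "D j = 0"
proof (rule puiseux_order_ge_imp_zero)
  show "puiseux_order_ge (r + of_nat n) (D j)" for n
  proof (induction n arbitrary: j)
    case 0
    then show ?case using bound by simp
  next
    case (Suc n)
    have "puiseux_order_ge (r + of_nat n) (\<Sum>l = 1..m. if int j + b l \<ge> 0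
        then puiseux_const (v l) * D (nat (int j + b l)) else 0)"
      using puiseux_order_ge_mult[OF puiseux_order_ge_fps Suc.IH]
      by (intro puiseux_order_ge_sum) auto
    from puiseux_order_ge_mult[OF puiseux_order_ge_z this] show ?case
      by (subst rec) (simp add: algebra_simps)
  qed
qed

text \<open>At \<open>X = 1\<close> the kernel comes from a power series with constant term 1; hence
  \<open>T\<close> is a genuine quotient.\<close>

lemma puiseux_kernel_nonzero: "1 - puiseux_z * char_poly m b w 1 \<noteq> 0"
proof -
  let ?s = "\<Sum>l = 1..m. fps_const (complex_of_real (w l))"
  have "fps_nth (fps_X * ?s) 0 \<noteq> fps_nth 1 0" by simp
  then have "fps_X * ?s \<noteq> 1" by metis
  then have "puiseux_of_fps (fps_X * ?s) \<noteq> puiseux_of_fps 1"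
    using puiseux_of_fps_inject by blast
  then show ?thesis
    by (simp add: puiseux_of_fps_arith puiseux_of_fps_sum char_poly_def)
qed

text \<open>A sufficiently high power of \<open>X\<close> clears the negative exponents of the
  characteristic polynomial, so that the closed form, which has natural exponents, can be compared
  with it.\<close>

lemma char_poly_mult_power:
  assumes "X \<noteq> 0" "\<And>l. l \<in> {1..m} \<Longrightarrow> int n + b l \<ge> 0"
  shows "X ^ n * char_poly m b w X =
     (\<Sum>l = 1..m. puiseux_const (complex_of_real (w l)) * X ^ nat (int n + b l))"
  unfolding char_poly_def sum_distrib_left
proof (intro sum.cong refl)
  fix l assume l: "l \<in> {1..m}"
  have "X ^ n * X powi b l = X powi (int n + b l)"
    using assms(1) by (simp add: power_int_add)
  also have "\<dots> = X ^ nat (int n + b l)"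
    using assms(2)[OF l] by (simp add: power_int_def)
  finally show "X ^ n * (puiseux_const (complex_of_real (w l)) * X powi b l) =
      puiseux_const (complex_of_real (w l)) * X ^ nat (int n + b l)"
    by (simp add: mult.left_commute)
qed

text \<open>By \<open>card_small_solutions\<close> an enumeration \<open>X\<close> as assumed always
  exists; its order is arbitrary.\<close>

theorem corollary3:
  fixes m c j :: nat and b :: "nat \<Rightarrow> int" and w :: "nat \<Rightarrow> real"
    and X :: "nat \<Rightarrow> complex puiseux" and T :: "complex puiseux"
  assumes "m \<ge> 1"
    and "inj_on b {1..m}"
    and "\<And>l. l \<in> {1..m} \<Longrightarrow> w l > 0"
    and "int c = - Min (b ` {1..m})" and "c \<ge> 1"
    and "bij_betw X {1..c} (small_solutions m b w)"
    and "T = 1 / (1 - puiseux_z * char_poly m b w 1)"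
  shows "puiseux_of_fps (meander_gf m b w j) =
           T * (1 - (\<Sum>l = 1..c. diff_prod c (X(l := 1)) / diff_prod c X * X l ^ (c + j)))
       \<and> T * (1 - (\<Sum>l = 1..c. diff_prod c (X(l := 1)) / diff_prod c X * X l ^ (c + j))) =
           1 / (1 - puiseux_z * char_poly m b w 1)
             * (\<Sum>f = 0..j. complete_homogeneous c f X) * (\<Prod>l = 1..c. 1 - X l)"
proof
  have inj: "inj_on X {1..c}" using assms(6) by (simp add: bij_betw_def)
  show "T * (1 - (\<Sum>l = 1..c. diff_prod c (X(l := 1)) / diff_prod c X * X l ^ (c + j))) =
      1 / (1 - puiseux_z * char_poly m b w 1)
        * (\<Sum>f = 0..j. complete_homogeneous c f X) * (\<Prod>l = 1..c. 1 - X l)"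
    by (simp only: sum_complete_homogeneous[OF inj assms(5)] assms(7) mult.assoc)

  define A where "A = (\<lambda>l. diff_prod c (X(l := 1)) / diff_prod c X)"
  \<comment> \<open>This is the closed form with the level shifted up by \<open>c\<close>: the
    indices \<open>n < c\<close> stand for the negative levels from \<open>-c\<close> to
    \<open>-1\<close>.\<close>
  define V where "V = (\<lambda>n. T * (1 - (\<Sum>l = 1..c. A l * X l ^ n)))"
  define v where "v = (\<lambda>l. complex_of_real (w l))"
  have small: "X l \<in> small_solutions m b w" if "l \<in> {1..c}" for l
    using assms(6) that by (auto simp: bij_betw_def)
  \<comment> \<open>The zero series has order 0 by convention, so positivity of the order excludes
    it.\<close>
  have X0: "X l \<noteq> 0" if "l \<in> {1..c}" for l
  proof
    assume "X l = 0"
    then have "puiseux_order (0 :: complex puiseux) > 0"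
      using small[OF that] by (simp add: small_solutions_def)
    then show False by (simp add: zero_puiseux_def puiseux_order_root)
  qed
  have X_eq: "puiseux_z * char_poly m b w (X l) = 1" if "l \<in> {1..c}" for l
    using small[OF that] by (simp add: small_solutions_def)
  have X_order: "puiseux_order_ge 0 (X l)" if "l \<in> {1..c}" for l
    using small[OF that] by (simp add: small_solutions_def puiseux_order_ge_def)
  have T: "T * (puiseux_z * char_poly m b w 1) = T - 1"
    using puiseux_kernel_nonzero[of m b w] by (simp add: assms(7) field_simps)
  have b: "int c + b l \<ge> 0" if "l \<in> {1..m}" for l
  proof -
    have "Min (b ` {1..m}) \<le> b l" using that by (intro Min_le) auto
    then show ?thesis using assms(4) by linarith
  qed

  \<comment> \<open>Here the sum interpolates \<open>x ^ n\<close> at 1 and equals 1.\<close>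
  have V0: "V n = 0" if "n < c" for n
    using sum_diff_prod_ratio_power[OF inj that, of 1] by (simp add: V_def A_def)
  \<comment> \<open>In the recurrence without boundary the constant part contributes
    \<open>T - 1\<close> by \<open>T\<close>, which is where the summand 1 comes from. Each power
    \<open>X l ^ (c + j)\<close> is reproduced because the kernel equation holds at
    \<open>X l\<close>.\<close>
  have V_rec: "V (c + j) = 1 + puiseux_z * (\<Sum>s = 1..m. puiseux_const (v s) * V (nat (int (c + j) + b s)))"
    for j
  proof -
    have nonneg: "int (c + j) + b s \<ge> 0" if "s \<in> {1..m}" for s using b[OF that] by simp
    have "(\<Sum>s = 1..m. puiseux_const (v s) * V (nat (int (c + j) + b s))) =
        T * ((\<Sum>s = 1..m. puiseux_const (v s)) -
          (\<Sum>s = 1..m. \<Sum>l = 1..c. A l * (puiseux_const (v s) * X l ^ nat (int (c + j) + b s))))"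
      unfolding sum_subtractf[symmetric] sum_distrib_left V_def
      by (intro sum.cong refl) (simp add: algebra_simps sum_distrib_left)
    also have "(\<Sum>s = 1..m. \<Sum>l = 1..c. A l * (puiseux_const (v s) * X l ^ nat (int (c + j) + b s))) =
        (\<Sum>l = 1..c. A l * (X l ^ (c + j) * char_poly m b w (X l)))"
      by (subst sum.swap, intro sum.cong refl)
        (simp only: char_poly_mult_power[OF X0 nonneg] v_def flip: sum_distrib_left)
    also have "(\<Sum>s = 1..m. puiseux_const (v s)) = char_poly m b w 1"
      by (simp add: char_poly_def v_def)
    finally have "puiseux_z * (\<Sum>s = 1..m. puiseux_const (v s) * V (nat (int (c + j) + b s))) =
        puiseux_z * (T * (char_poly m b w 1 - (\<Sum>l = 1..c. A l * (X l ^ (c + j) * char_poly m b w (X l)))))"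
      by (simp only:)
    also have "\<dots> = T * (puiseux_z * char_poly m b w 1) -
        T * (puiseux_z * (\<Sum>l = 1..c. A l * (X l ^ (c + j) * char_poly m b w (X l))))"
      by (simp add: algebra_simps)
    also have "puiseux_z * (\<Sum>l = 1..c. A l * (X l ^ (c + j) * char_poly m b w (X l))) =
        (\<Sum>l = 1..c. A l * X l ^ (c + j) * (puiseux_z * char_poly m b w (X l)))"
      unfolding sum_distrib_left by (simp add: mult_ac)
    also have "\<dots> = (\<Sum>l = 1..c. A l * X l ^ (c + j))"
      by (intro sum.cong refl) (simp add: X_eq)
    finally show ?thesis by (simp add: T V_def algebra_simps)
  qed
  \<comment> \<open>A step to a negative level gives an index below \<open>c\<close>, where
    \<open>V\<close> vanishes, so the boundary condition comes for free. As
    \<open>c \<ge> 1\<close>, this includes an index that \<open>nat\<close> truncates to 0.\<close>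
  have V_rec': "V (c + j) = 1 + puiseux_z * (\<Sum>s = 1..m. if int j + b s \<ge> 0
      then puiseux_const (v s) * V (c + nat (int j + b s)) else 0)" for j
  proof -
    have "puiseux_const (v s) * V (nat (int (c + j) + b s)) = (if int j + b s \<ge> 0
        then puiseux_const (v s) * V (c + nat (int j + b s)) else 0)" for s
    proof (cases "int j + b s \<ge> 0")
      case True
      then have "nat (int (c + j) + b s) = c + nat (int j + b s)" by linarith
      then show ?thesis using True by simp
    next
      case False
      then show ?thesis using assms(5) by (simp add: V0)
    qed
    then show ?thesis using V_rec[of j] by simp
  qed

  define G where "G = (\<lambda>j. puiseux_of_fps (meander_gf m b w j))"
  have G_rec: "G j = 1 + puiseux_z * (\<Sum>s = 1..m. if int j + b s \<ge> 0
      then puiseux_const (v s) * G (nat (int j + b s)) else 0)" for j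
    unfolding G_def v_def
    by (subst meander_gf_rec[OF assms(2)])
      (simp add: puiseux_of_fps_arith puiseux_of_fps_sum if_distrib[of puiseux_of_fps] cong: if_cong)

  \<comment> \<open>A bound uniform in the level: the \<open>X l\<close> have positive order, so
    their powers cannot lower the order of the finitely many coefficients \<open>T\<close> and
    \<open>T * A l\<close>. The entry 0 accounts for the power series \<open>G j\<close>.\<close>
  define r where "r = Min (insert 0 (puiseux_order ` insert T ((\<lambda>l. T * A l) ` {1..c})))"
  have r: "r \<le> 0" "r \<le> puiseux_order T" "\<And>l. l \<in> {1..c} \<Longrightarrow> r \<le> puiseux_order (T * A l)"
    unfolding r_def by (rule Min_le; fastforce)+
  have "G j - V (c + j) = 0"
  proof (rule meander_recurrence_unique[where D = "\<lambda>j. G j - V (c + j)" and m = m and b = b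
        and v = v and r = r])
    fix j
    show "G j - V (c + j) = puiseux_z * (\<Sum>l = 1..m. if int j + b l \<ge> 0
      then puiseux_const (v l) * (G (nat (int j + b l)) - V (c + nat (int j + b l))) else 0)"
      by (subst G_rec, subst V_rec')
        (auto simp: algebra_simps sum_distrib_left simp flip: sum_subtractf intro!: sum.cong)
    have "puiseux_order_ge (r + 0) (T * A l * X l ^ (c + j))" if "l \<in> {1..c}" for l
      using r(3)[OF that] X_order[OF that]
      by (intro puiseux_order_ge_mult puiseux_order_ge_power) (auto simp: puiseux_order_ge_def)
    then have "puiseux_order_ge r (\<Sum>l = 1..c. T * A l * X l ^ (c + j))"
      by (intro puiseux_order_ge_sum) simp
    moreover have "V (c + j) = T - (\<Sum>l = 1..c. T * A l * X l ^ (c + j))"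
      by (simp add: V_def algebra_simps sum_distrib_left)
    ultimately have "puiseux_order_ge r (V (c + j))"
      using r(2) by (auto intro!: puiseux_order_ge_diff simp: puiseux_order_ge_def[of r T])
    moreover have "puiseux_order_ge r (G j)"
      using puiseux_order_ge_mono[OF puiseux_order_ge_fps r(1)] by (simp add: G_def)
    ultimately show "puiseux_order_ge r (G j - V (c + j))"
      by (intro puiseux_order_ge_diff)
  qed
  then show "puiseux_of_fps (meander_gf m b w j) =
      T * (1 - (\<Sum>l = 1..c. diff_prod c (X(l := 1)) / diff_prod c X * X l ^ (c + j)))"
    by (simp add: G_def V_def A_def)
qed

end
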